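(* If $n\equiv 3 \pmod 4$ and $\phi$ is an $\frac{n-1}{2}$-isometry of $\mathcal{C}_n$, then $\phi$ is an $\{\frac{n-1}{2},\frac{n+1}{2},n\}$-isometry. If $n\equiv 1 \pmod 4$ and $\phi$ is an $\frac{n-1}{2}$-isometry of $\mathcal{C}_n$, then $\phi$ is an even isometry.
   Context: $\mathcal{C}_n=\{0,1\}^n$ is the Boolean cube with Hamming distance $d$. For $P\subset\{1,\ldots,n\}$, a $P$-isometry is a bijection $\phi$ of $\mathcal{C}_n$ such that, for each $p\in P$, $d(\phi(x),\phi(y))=p$ whenever $d(x,y)=p$; a $p$-isometry is a $\{p\}$-isometry, where $p\in\{1,\ldots,n\}$. An even isometry is a $P$-isometry with $P$ the set of all even numbers in $\{1,\ldots,n\}$. *)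

theory Defs
  imports Complex_Main "HOL-Library.FuncSet"
begin

text \<open>
  The points of the cube are extensional functions on \<open>{1..n}\<close>, so that equality of points is
  coordinatewise equality and the cube has exactly \<open>2 ^ n\<close> points. Accordingly, a self-map of the
  cube is a HOL function of which only the values on the cube matter.
\<close>

definition cube :: "nat \<Rightarrow> (nat \<Rightarrow> nat) set" where
  "cube n = {1..n} \<rightarrow>\<^sub>E {0, 1}"

definition hamming_dist :: "nat \<Rightarrow> (nat \<Rightarrow> nat) \<Rightarrow> (nat \<Rightarrow> nat) \<Rightarrow> nat" where
  "hamming_dist n x y = card {i \<in> {1..n}. x i \<noteq> y i}"

text \<open>
  Only distances in \<open>{1..n}\<close> are admitted. In particular there is no \<open>p\<close>-isometry for \<open>p = 0\<close>.
\<close>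

definition set_isometry :: "nat \<Rightarrow> nat set \<Rightarrow> ((nat \<Rightarrow> nat) \<Rightarrow> (nat \<Rightarrow> nat)) \<Rightarrow> bool" where
  "set_isometry n P \<phi> \<longleftrightarrow>
     P \<subseteq> {1..n} \<and>
     bij_betw \<phi> (cube n) (cube n) \<and>
     (\<forall>p\<in>P. \<forall>x\<in>cube n. \<forall>y\<in>cube n.
        hamming_dist n x y = p \<longrightarrow> hamming_dist n (\<phi> x) (\<phi> y) = p)"

definition single_isometry :: "nat \<Rightarrow> nat \<Rightarrow> ((nat \<Rightarrow> nat) \<Rightarrow> (nat \<Rightarrow> nat)) \<Rightarrow> bool" where
  "single_isometry n p \<phi> \<longleftrightarrow> set_isometry n {p} \<phi>"

definition even_isometry :: "nat \<Rightarrow> ((nat \<Rightarrow> nat) \<Rightarrow> (nat \<Rightarrow> nat)) \<Rightarrow> bool" where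
  "even_isometry n \<phi> \<longleftrightarrow> set_isometry n {p \<in> {1..n}. even p} \<phi>"

end

theory Submission
  imports Defs
begin

text \<open>
  Write \<open>n = 2 * m + 1\<close>. The number of points at distance \<open>a\<close> from \<open>x\<close> and \<open>b\<close> from \<open>y\<close> depends
  only on the distance of \<open>x\<close> and \<open>y\<close> (lemma \<open>card_sphere_inter\<close>), and an isometry for the
  distances \<open>a\<close> and \<open>b\<close> cannot change it (lemma \<open>set_isometry_card_sphere_inter\<close>), because on a
  finite cube a preserved distance is also reflected. So two distances with different counts are
  never confused by such a map.

  Let \<open>c d\<close> be the central binomial coefficient of \<open>2 * d\<close> over \<open>d\<close>. For \<open>a = b = m\<close> the count
  vanishes at odd distances, and at distance \<open>2 * d\<close> it is \<open>c d * c (m + 1 - d) / 2\<close>. Central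
  binomial coefficients are strictly log-convex, so this value determines \<open>d\<close> up to the reflection
  of \<open>d\<close> into \<open>m + 1 - d\<close> (lemma \<open>middle_isometry_even_distance\<close>): an isometry for the distance
  \<open>m\<close> can at most exchange \<open>2 * d\<close> with \<open>n + 1 - 2 * d\<close>.

  If \<open>m\<close> is odd, the even distance \<open>m + 1\<close> is the fixed point of this reflection and is therefore
  preserved. The counts for \<open>a = m\<close>, \<open>b = m + 1\<close> vanish at even distances and are again halved
  products of two central binomial coefficients at odd ones, and log-convexity shows that \<open>n\<close> is
  the only distance with its count.

  If \<open>m\<close> is even, the distance \<open>m\<close> itself is paired with \<open>m + 2\<close>. As \<open>m\<close> is preserved and
  reflected, \<open>m + 2\<close> is preserved too. At distance \<open>2 * d\<close>, passing from the count for
  \<open>a = b = m\<close> to the count for \<open>a = m\<close>, \<open>b = m + 2\<close> multiplies it by \<open>d / (d + 1)\<close>. This factor is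
  injective in \<open>d\<close>, hence it separates \<open>d\<close> from \<open>m + 1 - d\<close>, and every even distance is preserved.
\<close>

section \<open>Intersections of two spheres in the cube\<close>

definition sphere_inter :: "nat \<Rightarrow> nat \<Rightarrow> nat \<Rightarrow> (nat \<Rightarrow> nat) \<Rightarrow> (nat \<Rightarrow> nat) \<Rightarrow> (nat \<Rightarrow> nat) set" where
  "sphere_inter n a b x y = {z \<in> cube n. hamming_dist n x z = a \<and> hamming_dist n y z = b}"

lemma sphere_inter_cube: "z \<in> sphere_inter n a b x y \<Longrightarrow> z \<in> cube n"
  by (simp add: sphere_inter_def)

lemma finite_cube: "finite (cube n)"
  unfolding cube_def by (intro finite_PiE) auto

lemma hamming_dist_le: "hamming_dist n x y \<le> n"
proof -
  have "{i \<in> {1..n}. x i \<noteq> y i} \<subseteq> {1..n}" by blast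
  then show ?thesis
    unfolding hamming_dist_def
    by (metis card_atLeastAtMost card_mono diff_Suc_1 finite_atLeastAtMost)
qed

lemma cube_coordinate: "x \<in> cube n \<Longrightarrow> i \<in> {1..n} \<Longrightarrow> x i = 0 \<or> x i = 1"
  by (auto simp: cube_def PiE_def Pi_def)

text \<open>
  On the coordinates where \<open>x\<close> and \<open>y\<close> differ, \<open>z\<close> differs from exactly one of them; on the others
  it differs from both or from neither. This gives the second equation.
\<close>

lemma hamming_dist_split:
  assumes "x \<in> cube n" "y \<in> cube n" "z \<in> cube n"
  defines "S \<equiv> {i \<in> {1..n}. x i \<noteq> y i}"
  defines "A \<equiv> {i \<in> S. x i \<noteq> z i}" and "B \<equiv> {i \<in> {1..n} - S. x i \<noteq> z i}"
  shows "hamming_dist n x z = card A + card B"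
    and "hamming_dist n y z + card A = hamming_dist n x y + card B"
proof -
  have fin: "finite S" "finite A" "finite B" by (auto simp: S_def A_def B_def)
  have "{i \<in> {1..n}. x i \<noteq> z i} = A \<union> B" by (auto simp: S_def A_def B_def)
  moreover have "A \<inter> B = {}" by (auto simp: A_def B_def)
  ultimately show "hamming_dist n x z = card A + card B"
    using fin by (simp add: hamming_dist_def card_Un_disjoint)
  have "y i \<noteq> z i \<longleftrightarrow> x i = z i" if "i \<in> S" for i
    using that cube_coordinate[OF assms(1), of i] cube_coordinate[OF assms(2), of i]
      cube_coordinate[OF assms(3), of i] by (auto simp: S_def)
  then have "{i \<in> {1..n}. y i \<noteq> z i} = (S - A) \<union> B"
    by (auto simp: S_def A_def B_def)
  moreover have "(S - A) \<inter> B = {}" by (auto simp: B_def)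
  ultimately have "hamming_dist n y z = card (S - A) + card B"
    using fin by (simp add: hamming_dist_def card_Un_disjoint)
  moreover have "card (S - A) + card A = card S"
    using fin by (metis (no_types, lifting) A_def add.commute card_Diff_subset card_mono
        le_add_diff_inverse mem_Collect_eq subsetI)
  ultimately show "hamming_dist n y z + card A = hamming_dist n x y + card B"
    by (simp add: hamming_dist_def S_def)
qed

text \<open>
  Take \<open>s\<close> and \<open>t\<close> as the number of coordinates in which \<open>z\<close> differs from \<open>x\<close>, inside and outside
  the set where \<open>x\<close> and \<open>y\<close> differ. The two prescribed distances determine \<open>s\<close> and \<open>t\<close>, and then
  \<open>z\<close> is given by an independent choice of the two coordinate sets.
\<close>

lemma card_sphere_inter:
  assumes x: "x \<in> cube n" and y: "y \<in> cube n"
    and D: "hamming_dist n x y = D" and a: "a = s + t" and b: "b + s = D + t"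
  shows "card (sphere_inter n a b x y) = (D choose s) * ((n - D) choose t)"
proof -
  define S where "S = {i \<in> {1..n}. x i \<noteq> y i}"
  define L where "L = {A. A \<subseteq> S \<and> card A = s}"
  define R where "R = {B. B \<subseteq> {1..n} - S \<and> card B = t}"
  define f where "f = (\<lambda>z. ({i \<in> S. x i \<noteq> z i}, {i \<in> {1..n} - S. x i \<noteq> z i}))"
  define g where "g = (\<lambda>(A, B). \<lambda>i\<in>{1..n}. if i \<in> A \<union> B then 1 - x i else x i)"
  have cardS: "card S = D" using D by (simp add: S_def hamming_dist_def)
  have S: "finite S" "S \<subseteq> {1..n}" by (auto simp: S_def)
  have g_cube: "g (A, B) \<in> cube n" for A B
    using cube_coordinate[OF x] by (fastforce simp: g_def cube_def)
  have fg: "f (g (A, B)) = (A, B)" if "A \<subseteq> S" "B \<subseteq> {1..n} - S" for A B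
  proof -
    have neq: "x i \<noteq> g (A, B) i \<longleftrightarrow> i \<in> A \<union> B" if "i \<in> {1..n}" for i
      using cube_coordinate[OF x that] that by (auto simp: g_def)
    then show ?thesis using that S(2) unfolding f_def by blast
  qed
  have gf: "g (f z) = z" if "z \<in> cube n" for z
  proof
    fix i
    show "g (f z) i = z i"
    proof (cases "i \<in> {1..n}")
      case True
      then show ?thesis
        using cube_coordinate[OF x True] cube_coordinate[OF that True] by (auto simp: g_def f_def)
    next
      case False
      then show ?thesis using that by (auto simp: g_def f_def cube_def PiE_def extensional_def)
    qed
  qed
  have mem: "z \<in> sphere_inter n a b x y \<longleftrightarrow> f z \<in> L \<times> R" if "z \<in> cube n" for z
    using hamming_dist_split[OF x y that] that a b D
    by (auto simp: sphere_inter_def f_def L_def R_def S_def)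
  have "bij_betw f (sphere_inter n a b x y) (L \<times> R)"
  proof (rule bij_betw_byWitness[where f' = g])
    show "\<forall>z\<in>sphere_inter n a b x y. g (f z) = z"
      using gf by (auto simp: sphere_inter_def)
    show "\<forall>q\<in>L \<times> R. f (g q) = q" using fg by (auto simp: L_def R_def)
    show "f ` sphere_inter n a b x y \<subseteq> L \<times> R"
      using mem sphere_inter_cube by blast
    show "g ` (L \<times> R) \<subseteq> sphere_inter n a b x y"
    proof
      fix z assume "z \<in> g ` (L \<times> R)"
      then obtain A B where AB: "z = g (A, B)" "A \<in> L" "B \<in> R" by auto
      then have "f z = (A, B)" using fg by (auto simp: L_def R_def)
      then show "z \<in> sphere_inter n a b x y" using mem g_cube AB by auto
    qed
  qed
  then have "card (sphere_inter n a b x y) = card L * card R"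
    by (simp add: bij_betw_same_card card_cartesian_product)
  moreover have "card L = D choose s" using n_subsets[OF S(1)] cardS by (simp add: L_def)
  moreover have "card ({1..n} - S) = n - D" using S cardS by (simp add: card_Diff_subset)
  then have "card R = (n - D) choose t" using n_subsets[of "{1..n} - S"] by (simp add: R_def)
  ultimately show ?thesis by simp
qed

text \<open>
  Each coordinate contributes \<open>0\<close> or \<open>2\<close> to the sum of the three pairwise distances of points of
  the cube.
\<close>

lemma sphere_inter_parity:
  assumes "x \<in> cube n" "y \<in> cube n" "sphere_inter n a b x y \<noteq> {}"
  shows "even (a + b + hamming_dist n x y)"
proof -
  obtain z where z: "z \<in> cube n" "hamming_dist n x z = a" "hamming_dist n y z = b"
    using assms(3) by (auto simp: sphere_inter_def)
  obtain s t where "a = s + t" "b + s = hamming_dist n x y + t"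
    using hamming_dist_split[OF assms(1,2) z(1)] unfolding z(2,3) by blast
  then have "a + b + hamming_dist n x y = 2 * (hamming_dist n x y + t)" by simp
  then show ?thesis by simp
qed

section \<open>Invariance of the counts under isometries\<close>

text \<open>
  The map induced on the finite set of pairs at distance \<open>p\<close> is injective, hence onto, so a
  preserved distance is also reflected.
\<close>

lemma set_isometry_hamming_dist_iff:
  assumes iso: "set_isometry n P \<phi>" and p: "p \<in> P" and x: "x \<in> cube n" and y: "y \<in> cube n"
  shows "hamming_dist n (\<phi> x) (\<phi> y) = p \<longleftrightarrow> hamming_dist n x y = p"
proof
  show "hamming_dist n (\<phi> x) (\<phi> y) = p" if "hamming_dist n x y = p"
    using that iso p x y unfolding set_isometry_def by blast
next
  assume eq: "hamming_dist n (\<phi> x) (\<phi> y) = p"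
  define E where "E = {q \<in> cube n \<times> cube n. hamming_dist n (fst q) (snd q) = p}"
  have inj: "inj_on \<phi> (cube n)" and im: "\<phi> ` cube n = cube n"
    using iso by (auto simp: set_isometry_def bij_betw_def)
  have injE: "inj_on (map_prod \<phi> \<phi>) (cube n \<times> cube n)" using map_prod_inj_on[OF inj inj] .
  have sub: "E \<subseteq> cube n \<times> cube n" by (auto simp: E_def)
  have "finite E" using finite_subset[OF sub] finite_cube by blast
  moreover have "map_prod \<phi> \<phi> ` E \<subseteq> E"
    using iso p im unfolding E_def set_isometry_def by auto
  moreover have "inj_on (map_prod \<phi> \<phi>) E" using injE sub by (rule inj_on_subset)
  ultimately have "map_prod \<phi> \<phi> ` E = E" by (rule endo_inj_surj)
  moreover have "map_prod \<phi> \<phi> (x, y) \<in> E" using x y im eq by (auto simp: E_def)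
  ultimately have "(x, y) \<in> E"
    using injE sub x y by (metis SigmaI inj_on_image_mem_iff)
  then show "hamming_dist n x y = p" by (simp add: E_def)
qed

lemma set_isometry_card_sphere_inter:
  assumes iso: "set_isometry n P \<phi>" and "a \<in> P" "b \<in> P" and x: "x \<in> cube n" and y: "y \<in> cube n"
  shows "card (sphere_inter n a b (\<phi> x) (\<phi> y)) = card (sphere_inter n a b x y)"
proof -
  have inj: "inj_on \<phi> (cube n)" and im: "\<phi> ` cube n = cube n"
    using iso by (auto simp: set_isometry_def bij_betw_def)
  have "sphere_inter n a b (\<phi> x) (\<phi> y) = \<phi> ` sphere_inter n a b x y"
  proof (intro equalityI subsetI)
    fix z assume z: "z \<in> sphere_inter n a b (\<phi> x) (\<phi> y)"
    then obtain w where "w \<in> cube n" "z = \<phi> w" using im by (auto simp: sphere_inter_def)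
    then show "z \<in> \<phi> ` sphere_inter n a b x y"
      using z set_isometry_hamming_dist_iff[OF iso] assms by (auto simp: sphere_inter_def)
  next
    fix z assume "z \<in> \<phi> ` sphere_inter n a b x y"
    then show "z \<in> sphere_inter n a b (\<phi> x) (\<phi> y)"
      using set_isometry_hamming_dist_iff[OF iso] assms im by (auto simp: sphere_inter_def)
  qed
  moreover have "inj_on \<phi> (sphere_inter n a b x y)"
    using inj by (rule inj_on_subset) (auto simp: sphere_inter_def)
  ultimately show ?thesis by (simp add: card_image)
qed

section \<open>Log-convexity of central binomial coefficients\<close>

definition central_binomial :: "nat \<Rightarrow> nat" where
  "central_binomial d = (2 * d) choose d"

lemma central_binomial_pos: "central_binomial d > 0"
  by (simp add: central_binomial_def)

lemma central_binomial_Suc_eq_odd: "central_binomial (Suc d) = 2 * ((2 * d + 1) choose d)"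
  using binomial_symmetric[of d "2 * d + 1"] by (simp add: central_binomial_def)

lemma central_binomial_Suc:
  "Suc d * central_binomial (Suc d) = 2 * (2 * d + 1) * central_binomial d"
proof -
  have "Suc d * ((2 * d + 1) choose d) = (2 * d + 1) * central_binomial d"
    using binomial_absorb_comp[of "2 * d + 1" d] by (simp add: central_binomial_def Suc_diff_le)
  then show ?thesis unfolding central_binomial_Suc_eq_odd by simp
qed

text \<open>
  Strict log-convexity: the ratio of \<open>central_binomial (Suc d)\<close> to \<open>central_binomial d\<close> is
  \<open>4 - 2 / (d + 1)\<close>, which increases with \<open>d\<close>.
\<close>

lemma central_binomial_step:
  assumes "d < e"
  shows "central_binomial (Suc d) * central_binomial e
       < central_binomial d * central_binomial (Suc e)"
proof -
  let ?c = "central_binomial"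
  have "Suc d * Suc e * (?c (Suc d) * ?c e) = (Suc d * ?c (Suc d)) * (Suc e * ?c e)"
    by (simp only: mult_ac)
  also have "\<dots> = ((2 * d + 1) * Suc e) * (2 * ?c d * ?c e)"
    by (simp only: central_binomial_Suc mult_ac)
  also have "\<dots> < ((2 * e + 1) * Suc d) * (2 * ?c d * ?c e)"
    using assms central_binomial_pos by (intro mult_strict_right_mono) auto
  also have "\<dots> = (Suc d * ?c d) * (Suc e * ?c (Suc e))"
    by (simp only: central_binomial_Suc mult_ac)
  also have "\<dots> = Suc d * Suc e * (?c d * ?c (Suc e))"
    by (simp only: mult_ac)
  finally show ?thesis by (simp only: mult_less_cancel1)
qed

text \<open>
  Repeated steps: moving two indices apart while keeping their sum increases the product.
\<close>

lemma central_binomial_prod_less: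
  assumes "i < j" "j \<le> k" "i + l = j + k"
  shows "central_binomial j * central_binomial k < central_binomial i * central_binomial l"
proof -
  have "j \<le> k \<Longrightarrow>
      central_binomial j * central_binomial k
      < central_binomial (j - Suc r) * central_binomial (k + Suc r)" if "r < j" for r
    using that
  proof (induction r)
    case 0
    then show ?case using central_binomial_step[of "j - 1" k] by simp
  next
    case (Suc r)
    have "central_binomial j * central_binomial k
        < central_binomial (j - Suc r) * central_binomial (k + Suc r)" using Suc by simp
    also have "\<dots> < central_binomial (j - Suc (Suc r)) * central_binomial (k + Suc (Suc r))"
      using central_binomial_step[of "j - Suc (Suc r)" "k + Suc r"] Suc.prems
      by (simp add: Suc_diff_Suc)
    finally show ?case .
  qed
  moreover have "j - Suc (j - Suc i) = i" "k + Suc (j - Suc i) = l" "j - Suc i < j"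
    using assms by auto
  ultimately show ?thesis using assms(2) by metis
qed

lemma central_binomial_prod_eqD:
  assumes "central_binomial i * central_binomial l = central_binomial j * central_binomial k"
    and "i + l = j + k"
  shows "i = j \<or> i = k"
proof (rule ccontr)
  assume neq: "\<not> (i = j \<or> i = k)"
  consider "min i l < min j k" | "min j k < min i l" using neq assms(2) by linarith
  then show False
  proof cases
    case 1
    then show False using central_binomial_prod_less[of "min i l" "min j k" "max j k" "max i l"] assms
      by (auto simp: min_def max_def mult.commute split: if_splits)
  next
    case 2
    then show False using central_binomial_prod_less[of "min j k" "min i l" "max i l" "max j k"] assms
      by (auto simp: min_def max_def mult.commute split: if_splits)
  qed
qed

section \<open>Isometries for the middle distance of an odd-dimensional cube\<close>

lemma card_sphere_inter_middle:
  assumes "x \<in> cube (2 * m + 1)" "y \<in> cube (2 * m + 1)"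
    and "hamming_dist (2 * m + 1) x y = 2 * d" and "d \<le> m"
  shows "2 * card (sphere_inter (2 * m + 1) m m x y)
       = central_binomial d * central_binomial (m + 1 - d)"
proof -
  have "card (sphere_inter (2 * m + 1) m m x y)
      = ((2 * d) choose d) * ((2 * m + 1 - 2 * d) choose (m - d))"
    using assms by (intro card_sphere_inter) auto
  moreover have "2 * m + 1 - 2 * d = 2 * (m - d) + 1" and "m + 1 - d = Suc (m - d)"
    using assms(4) by auto
  ultimately show ?thesis
    by (simp only: central_binomial_Suc_eq_odd) (simp add: central_binomial_def)
qed

text \<open>
  The image distance is even because the count at odd distances is zero; log-convexity leaves the
  two solutions of the equation between the counts.
\<close>

lemma middle_isometry_even_distance:
  assumes iso: "set_isometry (2 * m + 1) P \<phi>" and m: "m \<in> P"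
    and x: "x \<in> cube (2 * m + 1)" and y: "y \<in> cube (2 * m + 1)"
    and d: "hamming_dist (2 * m + 1) x y = 2 * d"
  obtains e where "hamming_dist (2 * m + 1) (\<phi> x) (\<phi> y) = 2 * e" "e = d \<or> e = m + 1 - d"
proof -
  let ?n = "2 * m + 1"
  have px: "\<phi> x \<in> cube ?n" and py: "\<phi> y \<in> cube ?n"
    using iso x y by (auto simp: set_isometry_def bij_betw_def)
  have dm: "d \<le> m" using hamming_dist_le[of ?n x y] d by simp
  have card_eq: "card (sphere_inter ?n m m (\<phi> x) (\<phi> y)) = card (sphere_inter ?n m m x y)"
    using set_isometry_card_sphere_inter[OF iso m m x y] .
  have F: "2 * card (sphere_inter ?n m m x y) = central_binomial d * central_binomial (m + 1 - d)"
    using card_sphere_inter_middle[OF x y d dm] .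
  then have "card (sphere_inter ?n m m x y) > 0"
    using central_binomial_pos by (metis mult_pos_pos nat_0_less_mult_iff)
  then have "sphere_inter ?n m m (\<phi> x) (\<phi> y) \<noteq> {}" using card_eq by auto
  then have "even (hamming_dist ?n (\<phi> x) (\<phi> y))"
    using sphere_inter_parity[OF px py] by fastforce
  then obtain e where e: "hamming_dist ?n (\<phi> x) (\<phi> y) = 2 * e" by (auto elim: evenE)
  have em: "e \<le> m" using hamming_dist_le[of ?n "\<phi> x" "\<phi> y"] e by simp
  have "central_binomial e * central_binomial (m + 1 - e)
      = central_binomial d * central_binomial (m + 1 - d)"
    using card_sphere_inter_middle[OF px py e em] F card_eq by simp
  then have "e = d \<or> e = m + 1 - d"
    using central_binomial_prod_eqD em dm by (metis le_add1 le_add_diff_inverse le_trans)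
  then show ?thesis using that e by blast
qed

text \<open>
  For odd \<open>m\<close> the distance \<open>m + 1 = 2 * d\<close> has \<open>d = m + 1 - d\<close>, so its image cannot differ.
\<close>

lemma odd_middle_isometry:
  assumes iso: "set_isometry (2 * m + 1) {m} \<phi>" and m: "odd m"
  shows "set_isometry (2 * m + 1) {m, m + 1} \<phi>"
proof -
  let ?n = "2 * m + 1"
  obtain k where k: "m = 2 * k + 1" using m by (auto elim: oddE)
  have "hamming_dist ?n (\<phi> x) (\<phi> y) = m + 1"
    if x: "x \<in> cube ?n" and y: "y \<in> cube ?n" and "hamming_dist ?n x y = m + 1" for x y
  proof -
    have "hamming_dist ?n x y = 2 * (k + 1)" using that k by simp
    then obtain e where "hamming_dist ?n (\<phi> x) (\<phi> y) = 2 * e" "e = k + 1 \<or> e = m + 1 - (k + 1)"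
      using middle_isometry_even_distance[OF iso singletonI x y] by blast
    then show ?thesis using k by auto
  qed
  then show ?thesis using iso unfolding set_isometry_def by auto
qed

text \<open>
  At an odd distance \<open>2 * e + 1\<close> the count for \<open>m\<close> and \<open>m + 1\<close> is again half a product of two
  central binomial coefficients, and the antipodal distance is the extreme case \<open>e = m\<close>.
\<close>

lemma middle_pair_isometry_antipodal:
  assumes iso: "set_isometry (2 * m + 1) P \<phi>" and P: "m \<in> P" "m + 1 \<in> P"
    and x: "x \<in> cube (2 * m + 1)" and y: "y \<in> cube (2 * m + 1)"
    and d: "hamming_dist (2 * m + 1) x y = 2 * m + 1"
  shows "hamming_dist (2 * m + 1) (\<phi> x) (\<phi> y) = 2 * m + 1"
proof -
  let ?n = "2 * m + 1"
  have px: "\<phi> x \<in> cube ?n" and py: "\<phi> y \<in> cube ?n"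
    using iso x y by (auto simp: set_isometry_def bij_betw_def)
  have count: "2 * card (sphere_inter ?n m (m + 1) u v)
      = central_binomial (Suc e) * central_binomial (m - e)"
    if u: "u \<in> cube ?n" and v: "v \<in> cube ?n" and uv: "hamming_dist ?n u v = 2 * e + 1"
      and "e \<le> m" for u v e
  proof -
    have "card (sphere_inter ?n m (m + 1) u v)
        = ((2 * e + 1) choose e) * ((?n - (2 * e + 1)) choose (m - e))"
      using that by (intro card_sphere_inter) auto
    moreover have "?n - (2 * e + 1) = 2 * (m - e)" by simp
    ultimately show ?thesis
      by (simp only: central_binomial_Suc_eq_odd) (simp add: central_binomial_def)
  qed
  have card_eq: "card (sphere_inter ?n m (m + 1) (\<phi> x) (\<phi> y)) = card (sphere_inter ?n m (m + 1) x y)"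
    using set_isometry_card_sphere_inter[OF iso P x y] .
  have F: "2 * card (sphere_inter ?n m (m + 1) x y) = central_binomial (Suc m) * central_binomial 0"
    using count[OF x y d] by simp
  then have "card (sphere_inter ?n m (m + 1) x y) > 0"
    using central_binomial_pos by (metis mult_pos_pos nat_0_less_mult_iff)
  then have "sphere_inter ?n m (m + 1) (\<phi> x) (\<phi> y) \<noteq> {}" using card_eq by auto
  then have "odd (hamming_dist ?n (\<phi> x) (\<phi> y))"
    using sphere_inter_parity[OF px py] by fastforce
  then obtain e where e: "hamming_dist ?n (\<phi> x) (\<phi> y) = 2 * e + 1" by (auto elim: oddE)
  have em: "e \<le> m" using hamming_dist_le[of ?n "\<phi> x" "\<phi> y"] e by simp
  have "central_binomial (Suc e) * central_binomial (m - e)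
      = central_binomial (Suc m) * central_binomial 0"
    using count[OF px py e em] F card_eq by simp
  then have "Suc e = Suc m \<or> Suc e = 0"
    by (rule central_binomial_prod_eqD) (use em in simp)
  then show ?thesis using e by simp
qed

text \<open>
  For even \<open>m\<close> the only other candidate for the image of the distance \<open>m + 2\<close> is \<open>m\<close>, which is
  already the image of \<open>m\<close> and of no other distance.
\<close>

lemma even_middle_isometry:
  assumes iso: "set_isometry (2 * m + 1) {m} \<phi>" and m: "even m"
  shows "set_isometry (2 * m + 1) {m, m + 2} \<phi>"
proof -
  let ?n = "2 * m + 1"
  obtain k where k: "m = 2 * k" using m by (auto elim: evenE)
  have "m \<ge> 1" using iso by (simp add: set_isometry_def)
  have "hamming_dist ?n (\<phi> x) (\<phi> y) = m + 2"
    if x: "x \<in> cube ?n" and y: "y \<in> cube ?n" and D: "hamming_dist ?n x y = m + 2" for x y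
  proof -
    have d: "hamming_dist ?n x y = 2 * (k + 1)" using D k by simp
    obtain e where e: "hamming_dist ?n (\<phi> x) (\<phi> y) = 2 * e" "e = k + 1 \<or> e = m + 1 - (k + 1)"
      using middle_isometry_even_distance[OF iso singletonI x y d] .
    have "hamming_dist ?n (\<phi> x) (\<phi> y) \<noteq> m"
      using set_isometry_hamming_dist_iff[OF iso singletonI x y] D by simp
    then show ?thesis using e k by auto
  qed
  then show ?thesis using iso \<open>m \<ge> 1\<close> k unfolding set_isometry_def by auto
qed

text \<open>
  The two counts \<open>F\<close> for \<open>(m, m)\<close> and \<open>G\<close> for \<open>(m, m + 2)\<close> satisfy \<open>(d + 1) * G = d * F\<close> at
  distance \<open>2 * d\<close>, and \<open>F\<close> is positive, so together they determine \<open>d\<close>.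
\<close>

lemma middle_pair_isometry_even_distance:
  assumes iso: "set_isometry (2 * m + 1) P \<phi>" and P: "m \<in> P" "m + 2 \<in> P"
    and x: "x \<in> cube (2 * m + 1)" and y: "y \<in> cube (2 * m + 1)"
    and d: "hamming_dist (2 * m + 1) x y = 2 * d" and "d > 0"
  shows "hamming_dist (2 * m + 1) (\<phi> x) (\<phi> y) = 2 * d"
proof -
  let ?n = "2 * m + 1"
  have px: "\<phi> x \<in> cube ?n" and py: "\<phi> y \<in> cube ?n"
    using iso x y by (auto simp: set_isometry_def bij_betw_def)
  have ratio: "Suc d * card (sphere_inter ?n m (m + 2) u v) = d * card (sphere_inter ?n m m u v)"
    if u: "u \<in> cube ?n" and v: "v \<in> cube ?n" and uv: "hamming_dist ?n u v = 2 * d"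
      and "d > 0" "d \<le> m" for u v d
  proof -
    have r: "?n - 2 * d = 2 * (m - d) + 1" using \<open>d \<le> m\<close> by auto
    have F: "card (sphere_inter ?n m m u v) = ((2 * d) choose d) * ((?n - 2 * d) choose (m - d))"
      using that by (intro card_sphere_inter) auto
    have G: "card (sphere_inter ?n m (m + 2) u v)
        = ((2 * d) choose (d - 1)) * ((?n - 2 * d) choose (m - d + 1))"
      using that by (intro card_sphere_inter) auto
    have sym: "(?n - 2 * d) choose (m - d + 1) = (?n - 2 * d) choose (m - d)"
      using binomial_symmetric[of "m - d" "2 * (m - d) + 1"] unfolding r by simp
    have "Suc d * ((2 * d) choose (d - 1)) = d * ((2 * d) choose d)"
      using binomial_absorb_comp[of "2 * d" "d - 1"] binomial_absorption[of "d - 1" "2 * d"] \<open>d > 0\<close>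
      by (cases d) auto
    then show ?thesis unfolding F G sym by (metis mult.assoc)
  qed
  have dm: "d \<le> m" using hamming_dist_le[of ?n x y] d by simp
  obtain e where e: "hamming_dist ?n (\<phi> x) (\<phi> y) = 2 * e" "e = d \<or> e = m + 1 - d"
    using middle_isometry_even_distance[OF iso P(1) x y d] .
  have e_bounds: "e > 0" "e \<le> m" using e(2) dm \<open>d > 0\<close> by auto
  define F where "F = card (sphere_inter ?n m m x y)"
  define G where "G = card (sphere_inter ?n m (m + 2) x y)"
  have "2 * F = central_binomial d * central_binomial (m + 1 - d)"
    unfolding F_def using card_sphere_inter_middle[OF x y d dm] .
  then have "F > 0" using central_binomial_pos by (metis mult_pos_pos nat_0_less_mult_iff)
  have 1: "Suc d * G = d * F" unfolding F_def G_def using ratio[OF x y d \<open>d > 0\<close> dm] .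
  have 2: "Suc e * G = e * F"
    unfolding F_def G_def using ratio[OF px py e(1) e_bounds]
      set_isometry_card_sphere_inter[OF iso P(1) P(1) x y]
      set_isometry_card_sphere_inter[OF iso P x y] by simp
  have "(Suc e * d) * F = Suc e * (Suc d * G)" unfolding 1 by (simp only: mult.assoc)
  also have "\<dots> = Suc d * (Suc e * G)" by (simp only: mult_ac)
  also have "\<dots> = (Suc d * e) * F" unfolding 2 by (simp only: mult.assoc)
  finally have "Suc e * d = Suc d * e" using \<open>F > 0\<close> by (metis mult_cancel2 less_irrefl)
  then have "e = d" by (simp add: mult.commute)
  then show ?thesis using e(1) by simp
qed

theorem theorem7:
  fixes n :: nat and \<phi> :: "(nat \<Rightarrow> nat) \<Rightarrow> (nat \<Rightarrow> nat)"
  shows "(n mod 4 = 3 \<and> single_isometry n ((n - 1) div 2) \<phi>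
            \<longrightarrow> set_isometry n {(n - 1) div 2, (n + 1) div 2, n} \<phi>) \<and>
         (n mod 4 = 1 \<and> single_isometry n ((n - 1) div 2) \<phi>
            \<longrightarrow> even_isometry n \<phi>)"
proof (intro conjI impI; elim conjE)
  assume "n mod 4 = 3" and iso: "single_isometry n ((n - 1) div 2) \<phi>"
  define m where "m = (n - 1) div 2"
  have n: "n = 2 * m + 1" and "odd m" and m: "(n - 1) div 2 = m" "(n + 1) div 2 = m + 1"
    using \<open>n mod 4 = 3\<close> unfolding m_def by presburger+
  have mid: "set_isometry n {m, m + 1} \<phi>"
    using odd_middle_isometry iso \<open>odd m\<close> unfolding single_isometry_def m unfolding n by blast
  have "hamming_dist n (\<phi> x) (\<phi> y) = n"
    if "x \<in> cube n" "y \<in> cube n" "hamming_dist n x y = n" for x y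
    using middle_pair_isometry_antipodal[of m "{m, m + 1}" \<phi> x y] mid that unfolding n by simp
  then show "set_isometry n {(n - 1) div 2, (n + 1) div 2, n} \<phi>"
    using mid n unfolding m set_isometry_def by auto
next
  assume "n mod 4 = 1" and iso: "single_isometry n ((n - 1) div 2) \<phi>"
  define m where "m = (n - 1) div 2"
  have n: "n = 2 * m + 1" and "even m" and m: "(n - 1) div 2 = m"
    using \<open>n mod 4 = 1\<close> unfolding m_def by presburger+
  have mid: "set_isometry n {m, m + 2} \<phi>"
    using even_middle_isometry iso \<open>even m\<close> unfolding single_isometry_def m unfolding n by blast
  have "hamming_dist n (\<phi> x) (\<phi> y) = p"
    if "p \<in> {1..n}" "even p" "x \<in> cube n" "y \<in> cube n" "hamming_dist n x y = p" for p x y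
  proof -
    obtain d where "p = 2 * d" using \<open>even p\<close> by (auto elim: evenE)
    then show ?thesis
      using middle_pair_isometry_even_distance[of m "{m, m + 2}" \<phi> x y d] mid that
      unfolding n by simp
  qed
  then show "even_isometry n \<phi>"
    using mid unfolding even_isometry_def set_isometry_def by auto
qed

end
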